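(* The sequence $(\nu_5(F_{n+1}))_{n \geq 0}$ is a $5$-regular sequence of rank $2$.
   Context: $F_n$ denotes the $n$th Fibonacci number: $F_1 = F_2 = 1$ and $F_{n+2} = F_{n+1} + F_n$ for $n \geq 1$. For a prime $p$ and an integer $n \geq 1$, $\nu_p(n)$ is the exponent of the highest power of $p$ dividing $n$ (the $p$-adic valuation). For an integer $k \geq 2$, the $k$-kernel of a sequence $s(n)_{n \geq 0}$ is the set of sequences $\ker_k s(n)_{n\ge 0} = \{ s(k^e n + i)_{n \geq 0} : e \geq 0,\ 0 \leq i \leq k^e - 1 \}$. The sequence $s(n)_{n \geq 0}$ is $k$-regular if the $\mathbb{Z}$-module $\langle \ker_k s(n)_{n\ge 0} \rangle$ generated by its $k$-kernel (under termwise operations) is finitely generated. The rank of a $k$-regular sequence is the rank of this $\mathbb{Z}$-module (the maximal number of $\mathbb{Z}$-linearly independent elements). *)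

theory Defs
  imports
    "HOL-Number_Theory.Fib"
    "HOL-Computational_Algebra.Primes"
    "HOL-Library.Function_Algebras"
    "HOL-Library.Extended_Nat"
begin

definition seq_scale :: "int \<Rightarrow> (nat \<Rightarrow> int) \<Rightarrow> (nat \<Rightarrow> int)"
  where "seq_scale c s = (\<lambda>n. c * s n)"

lemma seq_scale_apply [simp]: "seq_scale c s n = c * s n"
  by (simp add: seq_scale_def)

(* Addition and zero of sequences are the pointwise ones of Function_Algebras. *)
global_interpretation seq: module seq_scale
  by standard (simp_all add: fun_eq_iff algebra_simps)

definition kernel_seqs :: "nat \<Rightarrow> (nat \<Rightarrow> int) \<Rightarrow> (nat \<Rightarrow> int) set"
  where "kernel_seqs k s = {(\<lambda>n. s (k ^ e * n + i)) | e i. i < k ^ e}"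

definition kernel_module :: "nat \<Rightarrow> (nat \<Rightarrow> int) \<Rightarrow> (nat \<Rightarrow> int) set"
  where "kernel_module k s = seq.span (kernel_seqs k s)"

(* The generators are arbitrary integer sequences; equality of the spans forces
   them to lie in the module. *)
definition k_regular :: "nat \<Rightarrow> (nat \<Rightarrow> int) \<Rightarrow> bool"
  where "k_regular k s \<longleftrightarrow>
    k \<ge> 2 \<and> (\<exists>G. finite G \<and> seq.span G = kernel_module k s)"

(* Maximal number of linearly independent elements of M. The supremum is taken in enat,
   so that it is infinity when there are arbitrarily large finite independent subsets;
   a finite value is attained. *)
definition module_rank :: "(nat \<Rightarrow> int) set \<Rightarrow> enat"
  where "module_rank M = (SUP B \<in> {B. B \<subseteq> M \<and> finite B \<and> seq.independent B}. enat (card B))"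

definition regular_rank :: "nat \<Rightarrow> (nat \<Rightarrow> int) \<Rightarrow> enat"
  where "regular_rank k s = module_rank (kernel_module k s)"

end

theory Submission
  imports Defs
begin

text \<open>The lifting identity \<open>F(5n) = 5 F(n) (5(F(n)^4 + q F(n)^2) + q^2)\<close>, where
\<open>q = F(n+1)^2 - F(n+1) F(n) - F(n)^2\<close> is \<open>1\<close> or \<open>-1\<close> by Cassini, and \<open>F(n+5) \<equiv> 3 F(n)\<close> modulo 5
give \<open>\<nu>(F(n)) = \<nu>(n)\<close> for the 5-adic valuation \<open>\<nu>\<close>. Hence \<open>s(n) = \<nu>(n+1)\<close>, every kernel sequence is
constant or of the form \<open>s + e\<close>, and the kernel module is free on \<open>s\<close> and the constant sequence 1.\<close>

section \<open>The 5-adic valuation of Fibonacci numbers\<close>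

lemma fib_add_5: "fib (n + 5) = 5 * fib (n + 1) + 3 * fib n"
  by (simp add: eval_nat_numeral)

lemma five_dvd_fib_iff: "5 dvd fib n \<longleftrightarrow> 5 dvd n"
proof (induction n rule: less_induct)
  case (less n)
  show ?case
  proof (cases "n < 5")
    case True
    then have "n \<in> {0, 1, 2, 3, 4}" by auto
    moreover have "fib 3 = 2" "fib 4 = 3" by (simp_all add: eval_nat_numeral)
    ultimately show ?thesis by auto
  next
    case False
    then obtain m where m: "n = m + 5"
      by (metis add.commute le_Suc_ex not_less)
    \<comment> \<open>3 is a unit modulo 5, so the factor does not affect divisibility.\<close>
    have "5 dvd 5 * fib (m + 1) + 3 * fib m \<longleftrightarrow> 5 dvd fib m" by presburger
    then have "5 dvd fib n \<longleftrightarrow> 5 dvd fib m" by (simp only: m fib_add_5)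
    also have "\<dots> \<longleftrightarrow> 5 dvd m" using less m by simp
    also have "\<dots> \<longleftrightarrow> 5 dvd n" unfolding m by presburger
    finally show ?thesis .
  qed
qed

text \<open>Obtained by expanding the addition formula for Fibonacci numbers. It is stated over the
  integers because \<open>q\<close> can be negative.\<close>

lemma fib_times_5:
  fixes n :: nat
  defines "a \<equiv> int (fib n)" and "b \<equiv> int (fib (n + 1))"
  defines "q \<equiv> b\<^sup>2 - b * a - a\<^sup>2"
  shows "int (fib (5 * n)) = 5 * a * (5 * (a ^ 4 + q * a\<^sup>2) + q\<^sup>2)"
proof -
  \<comment> \<open>\<open>c\<close> plays the role of F(n-1); at \<open>n = 0\<close> it is 1, the
    value of F(-1).\<close>
  define c where "c = b - a"
  have add: "int (fib (m + n)) = int (fib (m + 1)) * a + int (fib m) * c"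
    and add1: "int (fib (m + n + 1)) = int (fib (m + 1)) * b + int (fib m) * a" for m
  proof -
    show 1: "int (fib (m + n + 1)) = int (fib (m + 1)) * b + int (fib m) * a" for m
      using fib_add[of m n] by (simp add: a_def b_def algebra_simps)
    show "int (fib (m + n)) = int (fib (m + 1)) * a + int (fib m) * c"
    proof (cases m)
      case 0
      then show ?thesis by (simp add: a_def)
    next
      case (Suc k)
      with 1[of k] show ?thesis by (simp add: c_def algebra_simps)
    qed
  qed
  \<comment> \<open>With 5n written as a repeated sum, \<open>add\<close> and \<open>add1\<close>
    peel off one \<open>n\<close> at a time until only a polynomial identity in \<open>a\<close> and
    \<open>b\<close> remains.\<close>
  have "int (fib (n + n + n + n + n)) = 5 * a * (5 * (a ^ 4 + q * a\<^sup>2) + q\<^sup>2)"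
    unfolding add add1 q_def c_def a_def[symmetric] b_def[symmetric] by algebra
  moreover have "n + n + n + n + n = 5 * n" by simp
  ultimately show ?thesis by metis
qed

text \<open>The cofactor \<open>v\<close> is congruent to \<open>q\<^sup>2 = 1\<close> modulo 5, so
  the only new factor 5 is the explicit one.\<close>

lemma multiplicity_5_fib_times_5:
  assumes "n > 0"
  shows "multiplicity 5 (fib (5 * n)) = Suc (multiplicity 5 (fib n))"
proof -
  define a where "a = int (fib n)"
  define q where "q = (int (fib (n + 1)))\<^sup>2 - int (fib (n + 1)) * a - a\<^sup>2"
  define v where "v = 5 * (a ^ 4 + q * a\<^sup>2) + q\<^sup>2"
  have "q = (-1) ^ n"
    using fib_Cassini_int[of n] by (simp add: q_def a_def power2_eq_square algebra_simps)
  then have q: "q\<^sup>2 = 1" by (simp flip: power_mult)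
  have eq: "int (fib (5 * n)) = 5 * a * v"
    using fib_times_5[of n] by (simp add: v_def q_def a_def)
  have a: "a > 0" using assms by (simp add: a_def fib_neq_0_nat)
  \<comment> \<open>The sign of \<open>v\<close> is not evident from its formula; it is read off
    from \<open>fib (5 * n)\<close>, so that the factorisation can be moved to the naturals.\<close>
  have "0 \<le> 5 * a * v" unfolding eq[symmetric] by simp
  then have "0 \<le> v" using a by (simp add: zero_le_mult_iff)
  then obtain u where u: "v = int u" using zero_le_imp_eq_int by blast
  have "int (fib (5 * n)) = int (5 * fib n * u)" using eq by (simp add: u a_def)
  then have "fib (5 * n) = 5 * fib n * u" by (simp only: of_nat_eq_iff)
  moreover have "\<not> 5 dvd u"
  proof
    assume "5 dvd u"
    then have "5 dvd v" unfolding u by presburger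
    then show False unfolding v_def q by presburger
  qed
  moreover have "prime_elem (5::nat)" by simp
  moreover have "fib n \<noteq> 0" using fib_neq_0_nat[OF assms] by simp
  moreover have "u \<noteq> 0" using \<open>\<not> 5 dvd u\<close> by (metis dvd_0_right)
  ultimately show ?thesis
    by (simp add: prime_elem_multiplicity_mult_distrib not_dvd_imp_multiplicity_0)
qed

theorem multiplicity_5_fib: "multiplicity 5 (fib n) = multiplicity 5 n"
proof (induction n rule: less_induct)
  case (less n)
  show ?case
  proof (cases "n > 0 \<and> 5 dvd n")
    case True
    then obtain m where m: "n = 5 * m" "m > 0" by (auto elim: dvdE)
    then show ?thesis
      using less[of m]
      by (simp add: multiplicity_5_fib_times_5 multiplicity_times_same)
  next
    case False
    \<comment> \<open>For \<open>n = 0\<close> both sides agree because \<open>fib 0 = 0\<close>;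
      otherwise neither \<open>n\<close> nor \<open>fib n\<close> is divisible by 5.\<close>
    then show ?thesis
      by (cases "n = 0") (auto simp: not_dvd_imp_multiplicity_0 five_dvd_fib_iff)
  qed
qed

section \<open>Submodules of rank two\<close>

lemma mem_span_pair_iff:
  "f \<in> seq.span {g, h} \<longleftrightarrow> (\<exists>a b. \<forall>n. f n = a * g n + b * h n)"
proof -
  have "f \<in> seq.span {g, h} \<longleftrightarrow> (\<exists>a b. f - seq_scale a g = seq_scale b h)"
    by (auto simp: seq.span_insert seq.span_singleton)
  also have "\<dots> \<longleftrightarrow> (\<exists>a b. \<forall>n. f n = a * g n + b * h n)"
    by (auto simp: fun_eq_iff algebra_simps diff_eq_eq)
  finally show ?thesis .
qed

text \<open>Coefficients form a function on the set \<open>{f, g}\<close>; distinctness keeps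
  \<open>a\<close> and \<open>b\<close> attached to different elements.\<close>

lemma dependent_pairI:
  assumes "f \<noteq> g" "\<And>n. a * f n + b * g n = 0" "a \<noteq> 0 \<or> b \<noteq> 0"
  shows "seq.dependent {f, g}"
  unfolding seq.dependent_explicit
  using assms
  by (intro exI[of _ "{f, g}"] exI[of _ "\<lambda>x. if x = f then a else b"]) (auto simp: fun_eq_iff)

lemma dependent_tripleI:
  assumes "f \<noteq> g" "f \<noteq> h" "g \<noteq> h" "\<And>n. a * f n + b * g n + c * h n = 0"
    and "a \<noteq> 0 \<or> b \<noteq> 0 \<or> c \<noteq> 0"
  shows "seq.dependent {f, g, h}"
  unfolding seq.dependent_explicit
  using assms
  by (intro exI[of _ "{f, g, h}"] exI[of _ "\<lambda>x. if x = f then a else if x = g then b else c"])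
    (auto simp: fun_eq_iff add.assoc)

text \<open>The cross product of the coefficient vectors (a1, a2, a3) and (b1, b2, b3) is orthogonal
  to both, so its entries are the coefficients of an integer relation, found without
  division.\<close>

lemma dependent_triple_in_span_pair:
  assumes "f1 \<in> seq.span {g, h}" "f2 \<in> seq.span {g, h}" "f3 \<in> seq.span {g, h}"
    and d: "f1 \<noteq> f2" "f1 \<noteq> f3" "f2 \<noteq> f3"
  shows "seq.dependent {f1, f2, f3}"
proof -
  obtain a1 b1 a2 b2 a3 b3 where
    f: "\<And>n. f1 n = a1 * g n + b1 * h n" "\<And>n. f2 n = a2 * g n + b2 * h n"
      "\<And>n. f3 n = a3 * g n + b3 * h n"
    using assms(1-3) unfolding mem_span_pair_iff by metis
  show ?thesis
  proof (cases "a2 * b3 - a3 * b2 = 0 \<and> a3 * b1 - a1 * b3 = 0 \<and> a1 * b2 - a2 * b1 = 0")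
    case False
    then show ?thesis
      using d by (intro dependent_tripleI[where a = "a2 * b3 - a3 * b2" and b = "a3 * b1 - a1 * b3"
            and c = "a1 * b2 - a2 * b1"]) (auto simp: f algebra_simps)
  next
    case True
    \<comment> \<open>When the cross product vanishes, two elements suffice: a2 f1 = a1 f2, or b2 f1
      = b1 f2 if a1 = a2 = 0.\<close>
    have "seq.dependent {f1, f2}"
    proof (cases "a1 = 0 \<and> a2 = 0")
      case True
      show ?thesis
      proof (cases "b1 = 0 \<and> b2 = 0")
        case b: True
        then have "f1 = f2" using True by (auto simp: f fun_eq_iff)
        with d show ?thesis by simp
      next
        case False
        then show ?thesis using True d
          by (intro dependent_pairI[where a = b2 and b = "- b1"]) (auto simp: f)
      qed
    next
      case a: False
      have "a2 * f1 n + (- a1) * f2 n = (a2 * b1 - a1 * b2) * h n" for n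
        by (simp add: f algebra_simps)
      then show ?thesis using a True d
        by (intro dependent_pairI[where a = a2 and b = "- a1"]) auto
    qed
    then show ?thesis by (rule seq.dependent_mono) auto
  qed
qed

text \<open>A larger independent set would contain a dependent triple, and the generating pair
  itself attains 2.\<close>

lemma module_rank_span_pair:
  assumes "g \<noteq> h" and ind: "seq.independent {g, h}"
  shows "module_rank (seq.span {g, h}) = 2"
  unfolding module_rank_def
proof (rule antisym)
  show "(SUP B \<in> {B. B \<subseteq> seq.span {g, h} \<and> finite B \<and> seq.independent B}. enat (card B)) \<le> 2"
  proof (rule SUP_least)
    fix B assume "B \<in> {B. B \<subseteq> seq.span {g, h} \<and> finite B \<and> seq.independent B}"
    then have B: "B \<subseteq> seq.span {g, h}" "finite B" "seq.independent B" by auto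
    have "card B \<le> 2"
    proof (rule ccontr)
      assume "\<not> card B \<le> 2"
      then obtain T where T: "T \<subseteq> B" "card T = 3"
        using obtain_subset_with_card_n[of 3 B] by auto
      then obtain f1 f2 f3 where T3: "T = {f1, f2, f3}" "f1 \<noteq> f2" "f1 \<noteq> f3" "f2 \<noteq> f3"
        by (auto simp: card_3_iff)
      then have "seq.dependent T"
        using dependent_triple_in_span_pair[of f1 g h f2 f3] T B by auto
      with T B show False using seq.dependent_mono by blast
    qed
    then show "enat (card B) \<le> 2" by (simp add: numeral_eq_enat)
  qed
  have "{g, h} \<in> {B. B \<subseteq> seq.span {g, h} \<and> finite B \<and> seq.independent B}"
    using ind seq.span_superset by auto
  then have "enat (card {g, h}) \<le>
      (SUP B \<in> {B. B \<subseteq> seq.span {g, h} \<and> finite B \<and> seq.independent B}. enat (card B))"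
    by (rule SUP_upper)
  then show "2 \<le> (SUP B \<in> {B. B \<subseteq> seq.span {g, h} \<and> finite B \<and> seq.independent B}. enat (card B))"
    using assms(1) by (simp add: numeral_eq_enat eval_nat_numeral)
qed

section \<open>The kernel of the valuation sequence\<close>

text \<open>Since 0 < r < p^e, the multiplicity of \<open>r\<close> is some k < e. Then p^(k+1)
  divides p^e n, so adding this term changes neither the divisibility by p^k nor the failure at
  p^(k+1).\<close>

lemma multiplicity_power_mult_add:
  fixes p r n :: nat
  assumes "prime p" "0 < r" "r < p ^ e"
  shows "multiplicity p (p ^ e * n + r) = multiplicity p r"
proof (rule multiplicity_eqI)
  let ?k = "multiplicity p r"
  have k: "p ^ ?k dvd r" by (rule multiplicity_dvd)
  then have "p ^ ?k \<le> r" using assms(2) by (rule dvd_imp_le)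
  with assms(3) have "p ^ ?k < p ^ e" by simp
  then have "?k < e" using prime_gt_1_nat[OF assms(1)] by simp
  then have e: "p ^ Suc ?k dvd p ^ e * n"
    by (intro dvd_mult2 le_imp_power_dvd) simp
  then show "p ^ ?k dvd p ^ e * n + r"
    using k by (meson dvd_add dvd_trans le_imp_power_dvd lessI less_imp_le)
  have "\<not> p ^ Suc ?k dvd r"
    using assms prime_gt_1_nat[OF assms(1)] by (subst power_dvd_iff_le_multiplicity) auto
  with e show "\<not> p ^ Suc ?k dvd p ^ e * n + r"
    using dvd_add_right_iff by blast
qed

lemma kernel_module_multiplicity:
  fixes p :: nat
  assumes p: "prime p"
  defines "s \<equiv> (\<lambda>n. int (multiplicity p (n + 1)))"
  shows "kernel_module p s = seq.span {s, \<lambda>_. 1}"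
proof -
  have p1: "p > 1" using p by (rule prime_gt_1_nat)
  \<comment> \<open>\<open>i = p ^ e - 1\<close> is the only residue for which p^e divides i + 1;
    all others fall under \<open>kernel_const\<close>.\<close>
  have kernel_last: "s (p ^ e * n + (p ^ e - 1)) = s n + int e" for e n
  proof -
    have "p ^ e * n + (p ^ e - 1) + 1 = p ^ e * (n + 1)"
      using p1 by (simp add: algebra_simps)
    moreover have "multiplicity p (p ^ e * (n + 1)) = e + multiplicity p (n + 1)"
      using p p1 by (subst prime_elem_multiplicity_mult_distrib) auto
    ultimately show ?thesis by (simp only: s_def)
  qed
  have kernel_const: "s (p ^ e * n + i) = s i" if "i + 1 < p ^ e" for e n i
    using multiplicity_power_mult_add[OF p, of "i + 1" e n] that by (simp add: s_def)
  have "seq.span (kernel_seqs p s) = seq.span {s, \<lambda>_. 1}"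
  proof (rule seq.span_eq[THEN iffD2], intro conjI subsetI)
    fix f assume "f \<in> kernel_seqs p s"
    then obtain e i where i: "i < p ^ e" and f: "f = (\<lambda>n. s (p ^ e * n + i))"
      by (auto simp: kernel_seqs_def)
    show "f \<in> seq.span {s, \<lambda>_. 1}"
    proof (cases "i = p ^ e - 1")
      case True
      show ?thesis unfolding mem_span_pair_iff f True kernel_last
        by (intro exI[of _ 1] exI[of _ "int e"]) simp
    next
      case False
      then have "i + 1 < p ^ e" using i by simp
      then show ?thesis unfolding mem_span_pair_iff f
        by (intro exI[of _ 0] exI[of _ "s i"]) (simp add: kernel_const)
    qed
  next
    \<comment> \<open>Conversely, \<open>e = 0\<close> gives \<open>s\<close> and the last residue
      for \<open>e = 1\<close> gives s + 1; their difference is the constant 1.\<close>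
    have "(\<lambda>n. s (p ^ 0 * n + 0)) \<in> kernel_seqs p s"
      unfolding kernel_seqs_def by (intro CollectI exI[of _ 0]) auto
    then have s: "s \<in> seq.span (kernel_seqs p s)" by (simp add: seq.span_base)
    have "(\<lambda>n. s (p ^ 1 * n + (p ^ 1 - 1))) \<in> kernel_seqs p s"
      unfolding kernel_seqs_def using p1 by (intro CollectI exI[of _ 1] exI[of _ "p ^ 1 - 1"]) auto
    then have "(\<lambda>n. s n + 1) \<in> seq.span (kernel_seqs p s)"
      unfolding kernel_last by (simp add: seq.span_base)
    then have "(\<lambda>n. s n + 1) - s \<in> seq.span (kernel_seqs p s)"
      using s by (rule seq.span_diff)
    moreover have "(\<lambda>n. s n + 1) - s = (\<lambda>_. 1)" by (simp add: fun_eq_iff)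
    ultimately show "f \<in> seq.span (kernel_seqs p s)" if "f \<in> {s, \<lambda>_. 1}" for f
      using s that by auto
  qed
  then show ?thesis by (simp add: kernel_module_def)
qed

text \<open>\<open>s\<close> is 0 at 0 and 1 at \<open>p - 1\<close>. In a vanishing combination the
  first point kills the coefficient of the constant, and the second then kills that of
  \<open>s\<close>.\<close>

lemma independent_multiplicity_const:
  fixes p :: nat
  assumes p: "prime p"
  defines "s \<equiv> (\<lambda>n. int (multiplicity p (n + 1)))"
  shows "s \<noteq> (\<lambda>_. 1)" and "seq.independent {s, \<lambda>_. 1}"
proof -
  have p1: "p > 1" using p by (rule prime_gt_1_nat)
  have s0: "s 0 = 0" by (simp add: s_def)
  have s1: "s (p - 1) = 1" using p p1 by (simp add: s_def prime_imp_prime_elem[THEN multiplicity_prime, simplified])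
  show ne: "s \<noteq> (\<lambda>_. 1)" using s0 by (metis zero_neq_one)
  have "u s = 0 \<and> u (\<lambda>_. 1) = 0"
    if "(\<Sum>f\<in>{s, \<lambda>_. 1}. seq_scale (u f) f) = 0" for u
  proof -
    have "u s * s n + u (\<lambda>_. 1) = 0" for n
      using fun_cong[OF that, of n] ne by simp
    from this[of 0] this[of "p - 1"] show ?thesis unfolding s0 s1 by simp
  qed
  then show "seq.independent {s, \<lambda>_. 1}"
    by (subst seq.dependent_finite) auto
qed

theorem theorem3p1:
  defines "s \<equiv> (\<lambda>n::nat. int (multiplicity (5::nat) (fib (n + 1))))"
  shows "k_regular 5 s \<and> regular_rank 5 s = 2"
proof -
  have p: "prime (5::nat)" by simp
  have s: "s = (\<lambda>n. int (multiplicity 5 (n + 1)))"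
    unfolding s_def multiplicity_5_fib ..
  have M: "kernel_module 5 s = seq.span {s, \<lambda>_. 1}"
    unfolding s by (rule kernel_module_multiplicity[OF p])
  have "k_regular 5 s"
    unfolding k_regular_def M by (intro conjI exI[of _ "{s, \<lambda>_. 1}"]) auto
  moreover have "regular_rank 5 s = 2"
    unfolding regular_rank_def M
    using independent_multiplicity_const[OF p] by (intro module_rank_span_pair) (simp_all add: s)
  ultimately show ?thesis by blast
qed

end
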